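(* Let $K,M\subseteq\mathbb{R}$ be compact sets of positive Lebesgue measure, and let $\psi:[0,|M|]\to[0,|K|]$ be an increasing lipeomorphism. There exists an increasing homeomorphism $\phi:M\to K$ satisfying $$\pi_K\circ\phi=\psi\circ\pi_M$$ if and only if $K$ and $M$ are fiber $\psi$-compatible.
   Context: $\lambda$ denotes Lebesgue measure and $|K|=\lambda(K)$. A lipeomorphism is a bi-Lipschitz homeomorphism. For compact $K\subseteq\mathbb{R}$ of positive measure (likewise for $M$), the measure projection is $\pi_K:K\to[0,|K|]$, $\pi_K(x)=\lambda([\min K,x]\cap K)$, and $E_K=\{t\in[0,|K|]:\#\pi_K^{-1}(t)>1\}$. Given an increasing lipeomorphism $\psi:[0,|M|]\to[0,|K|]$, the sets $K$ and $M$ are called fiber $\psi$-compatible if $\psi(E_M)=E_K$ and, for every $s\in E_M$, the fiber $\pi_M^{-1}(s)$ is order-isomorphic to the fiber $\pi_K^{-1}(\psi(s))$, i.e. there exists an increasing bijection $h_s:\pi_M^{-1}(s)\to\pi_K^{-1}(\psi(s))$. *)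

theory Defs
  imports "HOL-Analysis.Analysis"
begin

definition lipeomorphism :: "'a::metric_space set \<Rightarrow> 'b::metric_space set \<Rightarrow> ('a \<Rightarrow> 'b) \<Rightarrow> bool" where
  "lipeomorphism S T f \<longleftrightarrow>
     (\<exists>g. homeomorphism S T f g \<and> (\<exists>C. C-lipschitz_on S f) \<and> (\<exists>D. D-lipschitz_on T g))"

text \<open>``Increasing'' always means strictly increasing.  For a nonempty compact \<open>K\<close>, the infimum
  \<open>Inf K\<close> is attained and is the minimum of \<open>K\<close>.\<close>

definition measure_projection :: "real set \<Rightarrow> real \<Rightarrow> real" where
  "measure_projection K x = measure lebesgue ({Inf K..x} \<inter> K)"

definition fiber :: "real set \<Rightarrow> real \<Rightarrow> real set" where
  "fiber K t = {x \<in> K. measure_projection K x = t}"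

text \<open>Fibers may be infinite, so ``more than one point'' is expressed by two distinct elements
  rather than through \<open>card\<close>, which vanishes on infinite sets.\<close>

definition multiple_fiber_set :: "real set \<Rightarrow> real set" where
  "multiple_fiber_set K =
     {t \<in> {0..measure lebesgue K}. \<exists>x \<in> fiber K t. \<exists>y \<in> fiber K t. x \<noteq> y}"

definition order_isomorphic :: "real set \<Rightarrow> real set \<Rightarrow> bool" where
  "order_isomorphic A B \<longleftrightarrow> (\<exists>h. bij_betw h A B \<and> strict_mono_on A h)"

definition fiber_compatible :: "(real \<Rightarrow> real) \<Rightarrow> real set \<Rightarrow> real set \<Rightarrow> bool" where
  "fiber_compatible \<psi> K M \<longleftrightarrow>
     \<psi> ` multiple_fiber_set M = multiple_fiber_set K \<and>
     (\<forall>s \<in> multiple_fiber_set M. order_isomorphic (fiber M s) (fiber K (\<psi> s)))"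

end

theory Submission
  imports Defs
begin

text \<open>
  The measure projection of a compact set \<open>K\<close> of positive measure is a monotone surjection
  \<open>K \<rightarrow> [0, |K|]\<close> (\<open>measure_projection_image\<close>).  Hence its fibers are consecutive blocks
  that partition \<open>K\<close>, ordered like the points of the interval \<open>[0, |K|]\<close>.  An increasing
  bijection \<open>M \<rightarrow> K\<close> lying over \<open>\<psi>\<close> is therefore the same thing as a family of increasing
  bijections between the block of \<open>M\<close> over \<open>s\<close> and the block of \<open>K\<close> over \<open>\<psi> s\<close>: such a bijection
  restricts to the blocks (\<open>order_isomorphic_fibers\<close>), and a family of bijections of blocks can be
  glued (\<open>glue_order_isomorphisms\<close>).  For one-point blocks such a bijection always exists, so
  only the blocks with several points matter, and these are the ones that compatibility speaks of.

  Continuity costs nothing: on a compact subset of the line the order determines the topology,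
  so an increasing bijection between two compact sets is a homeomorphism
  (\<open>homeomorphism_strict_mono_compact\<close>).  This is why the isomorphisms of different fibers can be
  chosen independently of each other.
\<close>

section \<open>Increasing bijections between compact sets of reals\<close>

text \<open>The points of \<open>A\<close> whose image is at most \<open>c\<close> form an initial segment of \<open>A\<close>.  Since the image
  is compact, it has a largest value \<open>f m\<close> not exceeding \<open>c\<close>, so this segment is \<open>A \<inter> {..m}\<close> and is
  closed in \<open>A\<close>; likewise for final segments.\<close>

lemma continuous_on_strict_mono_compact_image:
  fixes f :: "real \<Rightarrow> real"
  assumes mono: "strict_mono_on A f" and comp: "compact (f ` A)"
  shows "continuous_on A f"
  unfolding continuous_on_def
proof (intro ballI order_tendstoI)
  fix x c assume x: "x \<in> A" and c: "c < f x"
  show "\<forall>\<^sub>F y in at x within A. c < f y"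
  proof (cases "f ` A \<inter> {..c} = {}")
    case True
    then have "c < f y" if "y \<in> A" for y
      using that by (auto simp: disjoint_iff not_le)
    then show ?thesis
      by (simp add: eventually_at_filter)
  next
    case False
    have "compact (f ` A \<inter> {..c})"
      using comp by (intro compact_Int_closed) auto
    from compact_attains_sup[OF this False]
    obtain m where m: "m \<in> A" "f m \<le> c" and max: "\<And>y. y \<in> A \<Longrightarrow> f y \<le> c \<Longrightarrow> f y \<le> f m"
      by auto
    have "m < x"
      using m c x mono by (meson not_le order.trans strict_mono_on_leD)
    then have "\<forall>\<^sub>F y in at x within A. m < y \<and> y \<in> A"
      by (intro eventually_conj order_tendstoD(1)[OF tendsto_ident_at])
         (auto simp: eventually_at_filter)
    then show ?thesis
      by eventually_elim (meson max m(1) mono not_le strict_mono_onD)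
  qed
next
  fix x c assume x: "x \<in> A" and c: "f x < c"
  show "\<forall>\<^sub>F y in at x within A. f y < c"
  proof (cases "f ` A \<inter> {c..} = {}")
    case True
    then have "f y < c" if "y \<in> A" for y
      using that by (auto simp: disjoint_iff not_le)
    then show ?thesis
      by (simp add: eventually_at_filter)
  next
    case False
    have "compact (f ` A \<inter> {c..})"
      using comp by (intro compact_Int_closed) auto
    from compact_attains_inf[OF this False]
    obtain m where m: "m \<in> A" "c \<le> f m" and min: "\<And>y. y \<in> A \<Longrightarrow> c \<le> f y \<Longrightarrow> f m \<le> f y"
      by auto
    have "x < m"
      using m c x mono by (meson not_le order.trans strict_mono_on_leD)
    then have "\<forall>\<^sub>F y in at x within A. y < m \<and> y \<in> A"
      by (intro eventually_conj order_tendstoD(2)[OF tendsto_ident_at])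
         (auto simp: eventually_at_filter)
    then show ?thesis
      by eventually_elim (meson min m(1) mono not_le strict_mono_onD)
  qed
qed

lemma homeomorphism_strict_mono_compact:
  fixes f :: "real \<Rightarrow> real"
  assumes "compact A" "compact B" "bij_betw f A B" "strict_mono_on A f"
  obtains g where "homeomorphism A B f g"
proof -
  have "continuous_on A f"
    using assms by (intro continuous_on_strict_mono_compact_image) (auto simp: bij_betw_def)
  then show thesis
    using homeomorphism_compact[of A f B] assms that by (auto simp: bij_betw_def)
qed

section \<open>Gluing order isomorphisms of fibers\<close>

text \<open>Points in the same fiber of \<open>p\<close> are compared by the chosen isomorphism of that fiber,
  points in different fibers by the strict monotonicity of \<open>r\<close>.\<close>

lemma glue_order_isomorphisms:
  fixes p q r :: "real \<Rightarrow> real"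
  assumes p: "mono_on A p" and q: "mono_on B q" and r: "strict_mono_on (p ` A) r"
    and onto: "r ` p ` A = q ` B"
    and iso: "\<And>s. s \<in> p ` A \<Longrightarrow> order_isomorphic {x \<in> A. p x = s} {y \<in> B. q y = r s}"
  obtains f where "bij_betw f A B" "strict_mono_on A f" "\<And>x. x \<in> A \<Longrightarrow> q (f x) = r (p x)"
proof -
  have "\<forall>s\<in>p ` A. \<exists>h. bij_betw h {x \<in> A. p x = s} {y \<in> B. q y = r s} \<and>
      strict_mono_on {x \<in> A. p x = s} h"
    using iso by (simp add: order_isomorphic_def)
  from bchoice[OF this]
  obtain h where bij: "\<And>s. s \<in> p ` A \<Longrightarrow> bij_betw (h s) {x \<in> A. p x = s} {y \<in> B. q y = r s}"
    and mono: "\<And>s. s \<in> p ` A \<Longrightarrow> strict_mono_on {x \<in> A. p x = s} (h s)"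
    by auto
  define f where "f x = h (p x) x" for x
  have f: "f x \<in> B" "q (f x) = r (p x)" if "x \<in> A" for x
    using bij_betwE[OF bij[of "p x"]] that by (auto simp: f_def)
  have less: "f x < f y" if "x \<in> A" "y \<in> A" "x < y" for x y
  proof (cases "p x = p y")
    case True
    then show ?thesis
      using strict_mono_onD[OF mono[of "p x"], of x y] that by (auto simp: f_def)
  next
    case False
    then have "p x < p y"
      using mono_onD[OF p, of x y] that by simp
    then have "q (f x) < q (f y)"
      using strict_mono_onD[OF r, of "p x" "p y"] f that by simp
    then show ?thesis
      using mono_onD[OF q, of "f y" "f x"] f that by (meson not_le)
  qed
  then have sm: "strict_mono_on A f"
    by (auto intro: strict_mono_onI)
  have "y \<in> f ` A" if y: "y \<in> B" for y
  proof -
    obtain s where s: "s \<in> p ` A" "q y = r s"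
      using onto y by (metis imageE imageI)
    then have "y \<in> h s ` {x \<in> A. p x = s}"
      using bij[OF s(1)] y by (simp add: bij_betw_def)
    then show ?thesis
      by (auto simp: f_def)
  qed
  then have "bij_betw f A B"
    using f sm by (auto simp: bij_betw_def strict_mono_on_imp_inj_on)
  then show thesis
    using that sm f by blast
qed

section \<open>The measure projection\<close>

lemma lmeasurable_compact_initial_segment:
  fixes K :: "real set"
  assumes "compact K"
  shows "{a..x} \<inter> K \<in> lmeasurable"
  using assms by (simp add: compact_Int lmeasurable_compact)

lemma mono_measure_projection:
  assumes "compact K"
  shows "mono (measure_projection K)"
proof (rule monoI)
  fix x y :: real assume "x \<le> y"
  then show "measure_projection K x \<le> measure_projection K y"
    unfolding measure_projection_def using lmeasurable_compact_initial_segment[OF assms]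
    by (intro measure_mono_fmeasurable) auto
qed

text \<open>Between \<open>x\<close> and \<open>y\<close> the projection can grow by at most the length of the interval
  \<open>{x..y}\<close>.\<close>

lemma lipschitz_measure_projection:
  assumes "compact K"
  shows "1-lipschitz_on UNIV (measure_projection K)"
proof (rule lipschitz_onI)
  have *: "\<bar>measure_projection K y - measure_projection K x\<bar> \<le> y - x" if "x \<le> y" for x y
  proof -
    have "measure_projection K y \<le> measure lebesgue (({Inf K..x} \<inter> K) \<union> {x..y})"
      unfolding measure_projection_def using lmeasurable_compact_initial_segment[OF assms]
      by (intro measure_mono_fmeasurable) auto
    also have "\<dots> \<le> measure_projection K x + measure lebesgue {x..y}"
      unfolding measure_projection_def using lmeasurable_compact_initial_segment[OF assms]
      by (intro measure_Un_le) auto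
    finally show ?thesis
      using that monoD[OF mono_measure_projection[OF assms] that] by simp
  qed
  show "dist (measure_projection K x) (measure_projection K y) \<le> 1 * dist x y" for x y
    using *[of x y] *[of y x] by (cases "x \<le> y") (auto simp: dist_real_def)
qed simp

text \<open>By the intermediate value theorem every \<open>t\<close> in the interval is the projection of some real
  \<open>x\<close> between the minimum and the maximum of \<open>K\<close>.  Moving \<open>x\<close> down to the last point of \<open>K\<close> that
  does not exceed it crosses a gap of \<open>K\<close>, which leaves the projection unchanged.\<close>

lemma measure_projection_image:
  assumes "compact K" "K \<noteq> {}"
  shows "measure_projection K ` K = {0..measure lebesgue K}"
proof
  show "measure_projection K ` K \<subseteq> {0..measure lebesgue K}"
    unfolding measure_projection_def
    using lmeasurable_compact_initial_segment[OF assms(1)] lmeasurable_compact[OF assms(1)]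
    by (auto intro!: measure_mono_fmeasurable)
next
  have bdd: "bdd_below K" "bdd_above K"
    using compact_imp_bounded[OF assms(1)]
    by (simp_all add: bounded_imp_bdd_below bounded_imp_bdd_above)
  have Inf: "Inf K \<in> K" and lower: "\<And>x. x \<in> K \<Longrightarrow> Inf K \<le> x"
    using closed_contains_Inf[OF assms(2) bdd(1)] assms(1) compact_imp_closed cInf_lower bdd
    by auto
  have upper: "\<And>x. x \<in> K \<Longrightarrow> x \<le> Sup K"
    using cSup_upper bdd by auto
  have "measure_projection K (Inf K) = 0"
    using Inf by (simp add: measure_projection_def Int_absorb2)
  moreover have "{Inf K..Sup K} \<inter> K = K"
    using lower upper by auto
  then have "measure_projection K (Sup K) = measure lebesgue K"
    by (simp add: measure_projection_def)
  moreover have "continuous_on {Inf K..Sup K} (measure_projection K)"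
    using lipschitz_on_continuous_on[OF lipschitz_measure_projection[OF assms(1)]]
      continuous_on_subset by blast
  ultimately have IVT: "\<exists>x\<ge>Inf K. measure_projection K x = t" if "t \<in> {0..measure lebesgue K}" for t
    using IVT'[of "measure_projection K" "Inf K" t "Sup K"] that upper[OF Inf] by auto
  show "{0..measure lebesgue K} \<subseteq> measure_projection K ` K"
  proof
    fix t assume "t \<in> {0..measure lebesgue K}"
    then obtain x where x: "Inf K \<le> x" "measure_projection K x = t"
      using IVT by blast
    have "compact (K \<inter> {..x})" "K \<inter> {..x} \<noteq> {}"
      using assms(1) x Inf by (auto intro: compact_Int_closed)
    from compact_attains_sup[OF this] obtain k
      where k: "k \<in> K" "k \<le> x" "\<And>y. y \<in> K \<Longrightarrow> y \<le> x \<Longrightarrow> y \<le> k"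
      by auto
    then have "{Inf K..k} \<inter> K = {Inf K..x} \<inter> K"
      by force
    then have "measure_projection K k = t"
      using x by (simp add: measure_projection_def)
    then show "t \<in> measure_projection K ` K"
      using k by blast
  qed
qed

lemma measure_projection_mem:
  assumes "compact K" "x \<in> K"
  shows "measure_projection K x \<in> {0..measure lebesgue K}"
  using measure_projection_image[of K] assms by blast

lemma fiber_nonempty:
  assumes "compact K" "K \<noteq> {}" "t \<in> {0..measure lebesgue K}"
  shows "fiber K t \<noteq> {}"
  using measure_projection_image[OF assms(1,2)] assms(3) by (force simp: fiber_def)

lemma singleton_fiber:
  assumes "compact K" "K \<noteq> {}" "t \<in> {0..measure lebesgue K}" "t \<notin> multiple_fiber_set K"
  obtains x where "fiber K t = {x}"
  using fiber_nonempty[OF assms(1-3)] assms(3,4) unfolding multiple_fiber_set_def by blast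

section \<open>Order-isomorphic fibers and fiber compatibility\<close>

lemma order_isomorphic_singletons: "order_isomorphic {x} {y}"
  unfolding order_isomorphic_def
  by (rule exI[of _ "\<lambda>_. y"]) (auto simp: bij_betw_def strict_mono_on_def)

lemma order_isomorphic_multiple_iff:
  assumes "order_isomorphic A B"
  shows "(\<exists>x\<in>A. \<exists>y\<in>A. x \<noteq> y) \<longleftrightarrow> (\<exists>x\<in>B. \<exists>y\<in>B. x \<noteq> y)"
proof -
  obtain h where "inj_on h A" "B = h ` A"
    using assms by (auto simp: order_isomorphic_def bij_betw_def)
  then show ?thesis
    by (auto simp: inj_on_eq_iff)
qed

text \<open>Compatibility amounts to one uniform condition on all fibers.  Since no fiber is empty, a
  fiber outside \<open>E\<^sub>M\<close> and its partner outside \<open>E\<^sub>K\<close> are single points, hence isomorphic.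
  Conversely, an order isomorphism can only join two fibers that both have several points or both
  have one, so isomorphisms between all fibers force \<open>\<psi> ` E\<^sub>M = E\<^sub>K\<close>.\<close>

lemma fiber_compatible_iff:
  assumes K: "compact K" "K \<noteq> {}" and M: "compact M" "M \<noteq> {}"
    and bij: "bij_betw \<psi> {0..measure lebesgue M} {0..measure lebesgue K}"
  shows "fiber_compatible \<psi> K M \<longleftrightarrow>
    (\<forall>s\<in>{0..measure lebesgue M}. order_isomorphic (fiber M s) (fiber K (\<psi> s)))"
    (is "_ \<longleftrightarrow> ?all")
proof
  assume comp: "fiber_compatible \<psi> K M"
  show ?all
  proof
    fix s assume s: "s \<in> {0..measure lebesgue M}"
    show "order_isomorphic (fiber M s) (fiber K (\<psi> s))"
    proof (cases "s \<in> multiple_fiber_set M")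
      case True
      then show ?thesis
        using comp by (auto simp: fiber_compatible_def)
    next
      case False
      have "\<psi> s \<notin> multiple_fiber_set K"
      proof
        assume "\<psi> s \<in> multiple_fiber_set K"
        then obtain s' where "s' \<in> multiple_fiber_set M" "\<psi> s = \<psi> s'"
          using comp by (auto simp: fiber_compatible_def)
        moreover from this have "s' \<in> {0..measure lebesgue M}"
          by (simp add: multiple_fiber_set_def)
        ultimately show False
          using False s bij by (metis bij_betw_def inj_onD)
      qed
      moreover have "\<psi> s \<in> {0..measure lebesgue K}"
        using bij s by (rule bij_betw_apply)
      ultimately show ?thesis
        using singleton_fiber[OF K] singleton_fiber[OF M s False] order_isomorphic_singletons
        by metis
    qed
  qed
next
  assume iso: ?all
  have "s \<in> multiple_fiber_set M \<longleftrightarrow> \<psi> s \<in> multiple_fiber_set K"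
    if s: "s \<in> {0..measure lebesgue M}" for s
    using order_isomorphic_multiple_iff[OF bspec[OF iso s]] s bij_betw_apply[OF bij s]
    by (simp add: multiple_fiber_set_def)
  moreover have "multiple_fiber_set M \<subseteq> {0..measure lebesgue M}"
    and "multiple_fiber_set K \<subseteq> \<psi> ` {0..measure lebesgue M}"
    using bij by (auto simp: multiple_fiber_set_def bij_betw_def)
  ultimately have "\<psi> ` multiple_fiber_set M = multiple_fiber_set K"
    by blast
  then show "fiber_compatible \<psi> K M"
    using iso by (auto simp: fiber_compatible_def multiple_fiber_set_def)
qed

text \<open>Injectivity of \<open>\<psi>\<close> is what makes the restriction onto: a point of the target fiber comes
  from some \<open>x\<close> in \<open>M\<close>, and \<open>\<psi>\<close> can only send the projection of \<open>x\<close> to \<open>\<psi> s\<close> if it is \<open>s\<close>.\<close>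

lemma order_isomorphic_fibers:
  assumes M: "compact M" and inj: "inj_on \<psi> {0..measure lebesgue M}"
    and bij: "bij_betw \<phi> M K" and mono: "strict_mono_on M \<phi>"
    and comm: "\<And>x. x \<in> M \<Longrightarrow> measure_projection K (\<phi> x) = \<psi> (measure_projection M x)"
    and s: "s \<in> {0..measure lebesgue M}"
  shows "order_isomorphic (fiber M s) (fiber K (\<psi> s))"
proof -
  have "\<psi> (measure_projection M x) = \<psi> s \<longleftrightarrow> measure_projection M x = s" if "x \<in> M" for x
    using inj_on_eq_iff[OF inj measure_projection_mem[OF M that] s] .
  then have "\<phi> ` fiber M s = fiber K (\<psi> s)"
    using bij comm by (auto simp: fiber_def bij_betw_def image_iff)
  moreover have sub: "fiber M s \<subseteq> M"
    by (auto simp: fiber_def)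
  ultimately have "bij_betw \<phi> (fiber M s) (fiber K (\<psi> s))"
    using bij by (auto intro: bij_betw_subset)
  moreover have "strict_mono_on (fiber M s) \<phi>"
    using mono sub by (rule monotone_on_subset)
  ultimately show ?thesis
    unfolding order_isomorphic_def by blast
qed

theorem theorem4p5:
  fixes K M :: "real set" and \<psi> :: "real \<Rightarrow> real"
  assumes "compact K" and "measure lebesgue K > 0"
    and "compact M" and "measure lebesgue M > 0"
    and "lipeomorphism {0..measure lebesgue M} {0..measure lebesgue K} \<psi>"
    and "strict_mono_on {0..measure lebesgue M} \<psi>"
  shows "(\<exists>\<phi> \<phi>'. homeomorphism M K \<phi> \<phi>' \<and> strict_mono_on M \<phi> \<and>
            (\<forall>x\<in>M. measure_projection K (\<phi> x) = \<psi> (measure_projection M x)))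
         \<longleftrightarrow> fiber_compatible \<psi> K M"
    (is "?lift \<longleftrightarrow> _")
proof -
  have ne: "K \<noteq> {}" "M \<noteq> {}"
    using assms(2,4) by auto
  have inj: "inj_on \<psi> {0..measure lebesgue M}"
    using assms(6) by (rule strict_mono_on_imp_inj_on)
  moreover have onto: "\<psi> ` {0..measure lebesgue M} = {0..measure lebesgue K}"
    using assms(5) by (auto simp: lipeomorphism_def homeomorphism_def)
  ultimately have bij: "bij_betw \<psi> {0..measure lebesgue M} {0..measure lebesgue K}"
    by (simp add: bij_betw_def)
  note image_K = measure_projection_image[OF assms(1) ne(1)]
    and image_M = measure_projection_image[OF assms(3) ne(2)]
  have "?lift \<longleftrightarrow> (\<forall>s\<in>{0..measure lebesgue M}. order_isomorphic (fiber M s) (fiber K (\<psi> s)))"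
  proof
    assume ?lift
    then obtain \<phi> \<phi>' where \<phi>: "homeomorphism M K \<phi> \<phi>'" "strict_mono_on M \<phi>"
      "\<And>x. x \<in> M \<Longrightarrow> measure_projection K (\<phi> x) = \<psi> (measure_projection M x)"
      by blast
    then have "bij_betw \<phi> M K"
      by (auto simp: bij_betw_def homeomorphism_def strict_mono_on_imp_inj_on)
    then show "\<forall>s\<in>{0..measure lebesgue M}. order_isomorphic (fiber M s) (fiber K (\<psi> s))"
      using order_isomorphic_fibers[OF assms(3) inj] \<phi>(2,3) by blast
  next
    assume "\<forall>s\<in>{0..measure lebesgue M}. order_isomorphic (fiber M s) (fiber K (\<psi> s))"
    then obtain \<phi> where \<phi>: "bij_betw \<phi> M K" "strict_mono_on M \<phi>"
      "\<And>x. x \<in> M \<Longrightarrow> measure_projection K (\<phi> x) = \<psi> (measure_projection M x)"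
      using glue_order_isomorphisms[of M "measure_projection M" K "measure_projection K" \<psi>]
        mono_measure_projection[OF assms(1)] mono_measure_projection[OF assms(3)]
        image_K image_M onto assms(6)
      by (auto simp: fiber_def intro: mono_imp_mono_on)
    obtain \<phi>' where "homeomorphism M K \<phi> \<phi>'"
      using homeomorphism_strict_mono_compact[OF assms(3,1) \<phi>(1,2)] .
    then show ?lift
      using \<phi>(2,3) by blast
  qed
  also have "\<dots> \<longleftrightarrow> fiber_compatible \<psi> K M"
    using fiber_compatible_iff[OF assms(1) ne(1) assms(3) ne(2) bij] by simp
  finally show ?thesis .
qed

end
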